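(* Let $(\mathfrak g,\varphi_i,\xi_i,\eta_i)$ be an almost $3$-contact Lie algebra with abelian structure such that $\mathfrak v\subset\mathfrak z(\mathfrak g)$. Then the horizontal subspace $\mathfrak h$ admits a Lie algebra structure and an abelian hypercomplex structure $\{J_1,J_2,J_3\}$ such that $\mathfrak g$ is the central extension of the Lie algebra $\mathfrak h$ by a $J_i$-invariant $\mathfrak v$-valued $2$-cocycle $\theta$ of $\mathfrak h$. Conversely, if $\mathfrak h$ is a Lie algebra equipped with an abelian hypercomplex structure $\{J_1,J_2,J_3\}$ and $\theta$ is a $J_i$-invariant $\mathbb R^3$-valued $2$-cocycle on $\mathfrak h$, then the central extension $\mathfrak g=\mathbb R^3\oplus_\theta\mathfrak h$ carries a natural abelian almost $3$-contact structure $(\varphi_i,\xi_i,\eta_i)$.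
   Context: An almost contact structure on a real Lie algebra $\mathfrak g$ is a triple $(\varphi,\xi,\eta)$, $\varphi\in\mathrm{End}(\mathfrak g)$, $\xi\in\mathfrak g$, $\eta\in\mathfrak g^*$, with $\varphi^2=-I+\eta\otimes\xi$ and $\eta(\xi)=1$. It is abelian if $\mathrm{ad}_\xi\circ\varphi=\varphi\circ\mathrm{ad}_\xi$ and $[\varphi X,\varphi Y]=[X,Y]$ for all $X,Y\in\operatorname{Ker}\eta$. An almost $3$-contact Lie algebra is a real Lie algebra $\mathfrak g$ of dimension $4n+3$ with three almost contact structures $(\varphi_i,\xi_i,\eta_i)$, $i=1,2,3$, such that for every even permutation $(i,j,k)$ of $(1,2,3)$: $\varphi_k=\varphi_i\varphi_j-\eta_j\otimes\xi_i=-\varphi_j\varphi_i+\eta_i\otimes\xi_j$, $\xi_k=\varphi_i\xi_j=-\varphi_j\xi_i$, $\eta_k=\eta_i\circ\varphi_j=-\eta_j\circ\varphi_i$. It is abelian if each $(\varphi_i,\xi_i,\eta_i)$ is abelian. The horizontal and vertical subspaces are $\mathfrak h=\bigcap_{i=1}^3\operatorname{Ker}\eta_i$ and $\mathfrak v=\langle\xi_1,\xi_2,\xi_3\rangle$; $\mathfrak z(\mathfrak g)$ is the center of $\mathfrak g$. An abelian hypercomplex structure on a Lie algebra is a triple $\{J_1,J_2,J_3\}$ of endomorphisms with $J_i^2=-I$, $J_1J_2=-J_2J_1=J_3$ and $[J_iX,J_iY]=[X,Y]$ for all $X,Y$ and $i=1,2,3$. For a finite-dimensional vector space $V$, a $V$-valued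 $2$-cocycle on $\mathfrak h$ is $\theta\in\bigwedge^2\mathfrak h^*\otimes V$ with $\theta([X,Y],Z)+\theta([Y,Z],X)+\theta([Z,X],Y)=0$ for all $X,Y,Z\in\mathfrak h$; it is $J_i$-invariant if $\theta(J_iX,J_iY)=\theta(X,Y)$ for all $i=1,2,3$ and $X,Y\in\mathfrak h$. The central extension $V\oplus_\theta\mathfrak h$ is the vector space $V\oplus\mathfrak h$ with $V$ central and bracket $[X,Y]'=\theta(X,Y)+[X,Y]$ for $X,Y\in\mathfrak h$. *)

theory Defs
  imports "HOL-Analysis.Cross3" "HOL-Analysis.Product_Vector"
begin

text \<open>
  Vector spaces are subspaces of a type of class \<^class>\<open>real_vector\<close>; maps between them are
  functions on the whole type of which only the values on the subspace matter.
  Triples are indexed by the three-element type \<open>3\<close>, with elements \<open>1\<close>, \<open>2\<close>, \<open>3\<close>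
  (where \<open>3 = 0\<close>).
\<close>

definition fin_dim :: "'a::real_vector set \<Rightarrow> bool" where
  "fin_dim S \<longleftrightarrow> (\<exists>B. finite B \<and> S \<subseteq> span B)"

definition linear_on :: "'a::real_vector set \<Rightarrow> ('a \<Rightarrow> 'b::real_vector) \<Rightarrow> bool" where
  "linear_on S f \<longleftrightarrow>
     (\<forall>x\<in>S. \<forall>y\<in>S. f (x + y) = f x + f y) \<and>
     (\<forall>c. \<forall>x\<in>S. f (c *\<^sub>R x) = c *\<^sub>R f x)"

definition endomorphism_on :: "'a::real_vector set \<Rightarrow> ('a \<Rightarrow> 'a) \<Rightarrow> bool" where
  "endomorphism_on S f \<longleftrightarrow> linear_on S f \<and> (\<forall>x\<in>S. f x \<in> S)"

definition alternating_on ::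
  "'a::real_vector set \<Rightarrow> 'b::real_vector set \<Rightarrow> ('a \<Rightarrow> 'a \<Rightarrow> 'b) \<Rightarrow> bool" where
  "alternating_on S V b \<longleftrightarrow>
     (\<forall>x\<in>S. \<forall>y\<in>S. b x y \<in> V) \<and>
     (\<forall>x\<in>S. linear_on S (\<lambda>y. b x y)) \<and>
     (\<forall>y\<in>S. linear_on S (\<lambda>x. b x y)) \<and>
     (\<forall>x\<in>S. b x x = 0)"

definition lie_algebra :: "'a::real_vector set \<Rightarrow> ('a \<Rightarrow> 'a \<Rightarrow> 'a) \<Rightarrow> bool" where
  "lie_algebra L br \<longleftrightarrow>
     subspace L \<and> alternating_on L L br \<and>
     (\<forall>x\<in>L. \<forall>y\<in>L. \<forall>z\<in>L. br (br x y) z + br (br y z) x + br (br z x) y = 0)"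

definition lie_center :: "'a::real_vector set \<Rightarrow> ('a \<Rightarrow> 'a \<Rightarrow> 'a) \<Rightarrow> 'a set" where
  "lie_center L br = {z \<in> L. \<forall>x\<in>L. br z x = 0}"

definition lie_isomorphism ::
  "'a::real_vector set \<Rightarrow> ('a \<Rightarrow> 'a \<Rightarrow> 'a) \<Rightarrow> 'b::real_vector set \<Rightarrow> ('b \<Rightarrow> 'b \<Rightarrow> 'b) \<Rightarrow>
   ('a \<Rightarrow> 'b) \<Rightarrow> bool" where
  "lie_isomorphism L br M br' f \<longleftrightarrow>
     linear_on L f \<and> bij_betw f L M \<and> (\<forall>x\<in>L. \<forall>y\<in>L. f (br x y) = br' (f x) (f y))"

definition almost_contact ::
  "'a::real_vector set \<Rightarrow> ('a \<Rightarrow> 'a) \<Rightarrow> 'a \<Rightarrow> ('a \<Rightarrow> real) \<Rightarrow> bool" where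
  "almost_contact L \<phi> \<xi> \<eta> \<longleftrightarrow>
     endomorphism_on L \<phi> \<and> \<xi> \<in> L \<and> linear_on L \<eta> \<and>
     (\<forall>x\<in>L. \<phi> (\<phi> x) = - x + \<eta> x *\<^sub>R \<xi>) \<and> \<eta> \<xi> = 1"

definition abelian_almost_contact ::
  "'a::real_vector set \<Rightarrow> ('a \<Rightarrow> 'a \<Rightarrow> 'a) \<Rightarrow> ('a \<Rightarrow> 'a) \<Rightarrow> 'a \<Rightarrow> ('a \<Rightarrow> real) \<Rightarrow> bool" where
  "abelian_almost_contact L br \<phi> \<xi> \<eta> \<longleftrightarrow>
     almost_contact L \<phi> \<xi> \<eta> \<and>
     (\<forall>x\<in>L. br \<xi> (\<phi> x) = \<phi> (br \<xi> x)) \<and>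
     (\<forall>x\<in>L. \<forall>y\<in>L. \<eta> x = 0 \<and> \<eta> y = 0 \<longrightarrow> br (\<phi> x) (\<phi> y) = br x y)"

text \<open>The even permutations of \<open>(1, 2, 3)\<close>.\<close>

definition even_triples :: "(3 \<times> 3 \<times> 3) set" where
  "even_triples = {(1, 2, 3), (2, 3, 1), (3, 1, 2)}"

definition almost_3_contact_lie_algebra ::
  "'a::real_vector set \<Rightarrow> ('a \<Rightarrow> 'a \<Rightarrow> 'a) \<Rightarrow>
   (3 \<Rightarrow> 'a \<Rightarrow> 'a) \<Rightarrow> (3 \<Rightarrow> 'a) \<Rightarrow> (3 \<Rightarrow> 'a \<Rightarrow> real) \<Rightarrow> bool" where
  "almost_3_contact_lie_algebra L br \<phi> \<xi> \<eta> \<longleftrightarrow>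
     lie_algebra L br \<and> fin_dim L \<and> (\<exists>n. dim L = 4 * n + 3) \<and>
     (\<forall>i. almost_contact L (\<phi> i) (\<xi> i) (\<eta> i)) \<and>
     (\<forall>(i, j, k) \<in> even_triples.
        (\<forall>x\<in>L. \<phi> k x = \<phi> i (\<phi> j x) - \<eta> j x *\<^sub>R \<xi> i) \<and>
        (\<forall>x\<in>L. \<phi> k x = - \<phi> j (\<phi> i x) + \<eta> i x *\<^sub>R \<xi> j) \<and>
        \<xi> k = \<phi> i (\<xi> j) \<and> \<xi> k = - \<phi> j (\<xi> i) \<and>
        (\<forall>x\<in>L. \<eta> k x = \<eta> i (\<phi> j x)) \<and>
        (\<forall>x\<in>L. \<eta> k x = - \<eta> j (\<phi> i x)))"

definition abelian_almost_3_contact_lie_algebra ::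
  "'a::real_vector set \<Rightarrow> ('a \<Rightarrow> 'a \<Rightarrow> 'a) \<Rightarrow>
   (3 \<Rightarrow> 'a \<Rightarrow> 'a) \<Rightarrow> (3 \<Rightarrow> 'a) \<Rightarrow> (3 \<Rightarrow> 'a \<Rightarrow> real) \<Rightarrow> bool" where
  "abelian_almost_3_contact_lie_algebra L br \<phi> \<xi> \<eta> \<longleftrightarrow>
     almost_3_contact_lie_algebra L br \<phi> \<xi> \<eta> \<and>
     (\<forall>i. abelian_almost_contact L br (\<phi> i) (\<xi> i) (\<eta> i))"

definition horizontal :: "'a::real_vector set \<Rightarrow> (3 \<Rightarrow> 'a \<Rightarrow> real) \<Rightarrow> 'a set" where
  "horizontal L \<eta> = {x \<in> L. \<forall>i. \<eta> i x = 0}"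

definition vertical :: "(3 \<Rightarrow> 'a::real_vector) \<Rightarrow> 'a set" where
  "vertical \<xi> = span (range \<xi>)"

definition abelian_hypercomplex ::
  "'a::real_vector set \<Rightarrow> ('a \<Rightarrow> 'a \<Rightarrow> 'a) \<Rightarrow> (3 \<Rightarrow> 'a \<Rightarrow> 'a) \<Rightarrow> bool" where
  "abelian_hypercomplex H br J \<longleftrightarrow>
     (\<forall>i. endomorphism_on H (J i)) \<and>
     (\<forall>i. \<forall>x\<in>H. J i (J i x) = - x) \<and>
     (\<forall>x\<in>H. J 1 (J 2 x) = J 3 x \<and> - J 2 (J 1 x) = J 3 x) \<and>
     (\<forall>i. \<forall>x\<in>H. \<forall>y\<in>H. br (J i x) (J i y) = br x y)"

definition two_cocycle ::
  "'a::real_vector set \<Rightarrow> ('a \<Rightarrow> 'a \<Rightarrow> 'a) \<Rightarrow> 'b::real_vector set \<Rightarrow> ('a \<Rightarrow> 'a \<Rightarrow> 'b) \<Rightarrow> bool" where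
  "two_cocycle H br V \<theta> \<longleftrightarrow>
     alternating_on H V \<theta> \<and>
     (\<forall>x\<in>H. \<forall>y\<in>H. \<forall>z\<in>H. \<theta> (br x y) z + \<theta> (br y z) x + \<theta> (br z x) y = 0)"

definition J_invariant ::
  "'a::real_vector set \<Rightarrow> (3 \<Rightarrow> 'a \<Rightarrow> 'a) \<Rightarrow> ('a \<Rightarrow> 'a \<Rightarrow> 'b::real_vector) \<Rightarrow> bool" where
  "J_invariant H J \<theta> \<longleftrightarrow> (\<forall>i. \<forall>x\<in>H. \<forall>y\<in>H. \<theta> (J i x) (J i y) = \<theta> x y)"

text \<open>
  The central extension of \<open>H\<close> by \<open>V\<close> is the vector space \<open>V \<times> H\<close> with the following bracket,
  which does not depend on the \<open>V\<close>-components, so that \<open>V \<times> {0}\<close> is central.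
\<close>

definition central_ext_bracket ::
  "('a \<Rightarrow> 'a \<Rightarrow> 'b) \<Rightarrow> ('a \<Rightarrow> 'a \<Rightarrow> 'a) \<Rightarrow> 'b \<times> 'a \<Rightarrow> 'b \<times> 'a \<Rightarrow> 'b::real_vector \<times> 'a::real_vector" where
  "central_ext_bracket \<theta> br p q = (\<theta> (snd p) (snd q), br (snd p) (snd q))"

text \<open>
  The natural structure on \<open>\<real>\<^sup>3 \<oplus> H\<close>: \<open>\<xi>\<^sub>i\<close> is the standard basis of \<open>\<real>\<^sup>3\<close>, \<open>\<eta>\<^sub>i\<close> its dual basis
  extended by \<open>0\<close> on \<open>H\<close>, and \<open>\<phi>\<^sub>i\<close> is \<open>J\<^sub>i\<close> on \<open>H\<close> and satisfies \<open>\<phi>\<^sub>i \<xi>\<^sub>i = 0\<close> and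
  \<open>\<phi>\<^sub>i \<xi>\<^sub>j = \<xi>\<^sub>k = - \<phi>\<^sub>j \<xi>\<^sub>i\<close> for even permutations \<open>(i, j, k)\<close>, that is, it acts on \<open>\<real>\<^sup>3\<close>
  as the cross product with \<open>\<xi>\<^sub>i\<close>.
\<close>

definition natural_xi :: "3 \<Rightarrow> (real^3) \<times> 'a::real_vector" where
  "natural_xi i = (axis i 1, 0)"

definition natural_eta :: "3 \<Rightarrow> (real^3) \<times> 'a::real_vector \<Rightarrow> real" where
  "natural_eta i p = fst p $ i"

definition natural_phi ::
  "(3 \<Rightarrow> 'a \<Rightarrow> 'a) \<Rightarrow> 3 \<Rightarrow> (real^3) \<times> 'a \<Rightarrow> (real^3) \<times> 'a::real_vector" where
  "natural_phi J i p = (cross3 (axis i 1) (fst p), J i (snd p))"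

end

theory Submission
  imports Defs
begin

text \<open>
  Evaluating \<open>\<eta>\<^sub>i\<close> on the \<open>\<xi>\<^sub>j\<close> shows that \<open>x \<mapsto> \<Sum>\<^sub>i \<eta>\<^sub>i(x) \<xi>\<^sub>i\<close> is the projection onto the vertical
  subspace along the horizontal one. When the vertical subspace is central, the bracket of
  \<open>\<g>\<close> is determined by its restriction to the horizontal subspace; the vertical component of this
  restriction is the cocycle, the horizontal component the Lie bracket, and both Jacobi-type
  identities are components of the Jacobi identity of \<open>\<g>\<close>.
  In the converse, the only condition that is not a direct computation is that the dimension
  of \<open>\<h>\<close> is a multiple of 4: an independent set with \<open>J\<close>-invariant span is enlarged
  by \<open>x, J\<^sub>1 x, J\<^sub>2 x, J\<^sub>3 x\<close> for any \<open>x\<close> outside that span until it is a basis of \<open>\<h>\<close>.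
\<close>

section \<open>Linear and alternating maps on subspaces\<close>

lemma linear_on_add: "linear_on S f \<Longrightarrow> x \<in> S \<Longrightarrow> y \<in> S \<Longrightarrow> f (x + y) = f x + f y"
  and linear_on_scale: "linear_on S f \<Longrightarrow> x \<in> S \<Longrightarrow> f (c *\<^sub>R x) = c *\<^sub>R f x"
  by (auto simp: linear_on_def)

lemma linear_on_zero: "linear_on S f \<Longrightarrow> subspace S \<Longrightarrow> f 0 = 0"
  using linear_on_scale[of S f 0 0] by (simp add: subspace_0)

lemma linear_on_neg: "linear_on S f \<Longrightarrow> x \<in> S \<Longrightarrow> f (- x) = - f x"
  using linear_on_scale[of S f x "-1"] by simp

lemma linear_on_diff:
  assumes "linear_on S f" "subspace S" "x \<in> S" "y \<in> S"
  shows "f (x - y) = f x - f y"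
  using linear_on_add[OF assms(1), of x "- y"] assms linear_on_neg[OF assms(1), of y]
  by (simp add: subspace_neg)

lemma linear_on_span_image:
  assumes f: "linear_on S f" and S: "subspace S" and C: "C \<subseteq> S" "f ` C \<subseteq> span D"
    and x: "x \<in> span C"
  shows "f x \<in> span D"
proof -
  \<comment> \<open>Linearity of \<open>f\<close> is available only on \<open>S\<close>, so the
    induction carries membership in \<open>S\<close> along.\<close>
  have "x \<in> S \<and> f x \<in> span D"
    using x
  proof (induction rule: span_induct_alt)
    case base
    then show ?case
      using linear_on_zero[OF f S] by (simp add: S subspace_0 span_zero)
  next
    case (step c y z)
    with C S have "y \<in> S" "c *\<^sub>R y \<in> S" by (auto intro: subspace_scale)
    with step C show ?case
      by (auto simp: linear_on_add[OF f] linear_on_scale[OF f] S intro!: subspace_add span_add span_scale)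
  qed
  then show ?thesis ..
qed

text \<open>Polarization: expand \<open>b (x + y) (x + y) = 0\<close>.\<close>

lemma alternating_on_skew:
  assumes b: "alternating_on S V b" and S: "subspace S" and x: "x \<in> S" and y: "y \<in> S"
  shows "b y x = - b x y"
proof -
  have xy: "x + y \<in> S" using x y S by (simp add: subspace_add)
  have "b (x + y) (x + y) = b x (x + y) + b y (x + y)"
    using b linear_on_add[of S "\<lambda>z. b z (x + y)" x y] x y xy by (auto simp: alternating_on_def)
  also have "\<dots> = (b x x + b x y) + (b y x + b y y)"
    using b linear_on_add[of S "b x" x y] linear_on_add[of S "b y" x y] x y
    by (auto simp: alternating_on_def)
  finally have "b x y + b y x = 0"
    using b x y xy by (auto simp: alternating_on_def)
  then show ?thesis by (simp add: eq_neg_iff_add_eq_0 add.commute)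
qed

text \<open>Composing the bracket of the whole algebra with a projection and restricting to the
  horizontal subspace is how both the new bracket and the cocycle arise.\<close>

lemma alternating_on_compose:
  assumes "alternating_on S T b" "linear_on T f" "f ` T \<subseteq> V" "S' \<subseteq> S"
  shows "alternating_on S' V (\<lambda>x y. f (b x y))"
proof -
  \<comment> \<open>\<open>T\<close> is an arbitrary set here; that it contains \<open>0\<close>
    comes from \<open>b x x = 0\<close> being a value of \<open>b\<close>.\<close>
  have "f (b x x) = 0" if "x \<in> S" for x
  proof -
    have "b x x = 0" "0 \<in> T" using assms(1) that by (force simp: alternating_on_def)+
    then show ?thesis using linear_on_scale[OF assms(2), of 0 0] by simp
  qed
  then show ?thesis
    using assms unfolding alternating_on_def linear_on_def
    by (auto simp: subset_iff image_subset_iff)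
qed

section \<open>Quaternionic relations and divisibility of the dimension by 4\<close>

text \<open>The definition gives only the products of \<open>J 1\<close> and \<open>J 2\<close>. The
  others follow by replacing \<open>J 3\<close> with \<open>J 1 J 2\<close> or
  \<open>- J 2 J 1\<close>, whichever puts two equal factors side by side, and cancelling their
  square.\<close>

lemma hypercomplex_relations:
  assumes "abelian_hypercomplex H br J" "subspace H" "x \<in> H"
  shows "J 1 (J 2 x) = J 3 x" "J 2 (J 1 x) = - J 3 x"
    "J 2 (J 3 x) = J 1 x" "J 3 (J 2 x) = - J 1 x"
    "J 3 (J 1 x) = J 2 x" "J 1 (J 3 x) = - J 2 x"
proof -
  have lin: "linear_on H (J i)" and mem: "\<And>y. y \<in> H \<Longrightarrow> J i y \<in> H" for i
    using assms(1) by (auto simp: abelian_hypercomplex_def endomorphism_on_def)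
  have sq: "J i (J i y) = - y" and 12: "J 1 (J 2 y) = J 3 y" and 21: "- J 2 (J 1 y) = J 3 y"
    if "y \<in> H" for i y
    using assms(1) that by (auto simp: abelian_hypercomplex_def)
  note neg = linear_on_neg[OF lin]
  show "J 1 (J 2 x) = J 3 x" using 12 assms by simp
  show "J 2 (J 1 x) = - J 3 x" using 21[of x] assms by (simp flip: 21)
  show "J 2 (J 3 x) = J 1 x"
    using 21[of x] sq[of "J 1 x" 2] neg[of "J 2 (J 1 x)" 2] assms mem by (metis minus_minus)
  show "J 3 (J 2 x) = - J 1 x"
    using 12[of "J 2 x"] sq[of x 2] neg[of x 1] assms mem by metis
  show "J 3 (J 1 x) = J 2 x"
    using 21[of "J 1 x"] sq[of x 1] neg[of x 2] assms mem by (metis minus_minus)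
  show "J 1 (J 3 x) = - J 2 x"
    using 12[of x] sq[of "J 2 x" 1] assms mem by metis
qed

text \<open>Multiply the quaternionic combination by the conjugate quaternion.\<close>

lemma hypercomplex_comb_coeffs_zero:
  assumes J: "abelian_hypercomplex H br J" and H: "subspace H" and x: "x \<in> H"
    and S: "subspace S" and inv: "\<And>i y. y \<in> S \<Longrightarrow> J i y \<in> S"
    and w: "a *\<^sub>R x + b *\<^sub>R J 1 x + c *\<^sub>R J 2 x + d *\<^sub>R J 3 x \<in> S" and nS: "x \<notin> S"
  shows "a = 0 \<and> b = 0 \<and> c = 0 \<and> d = 0"
proof -
  define w where "w = a *\<^sub>R x + b *\<^sub>R J 1 x + c *\<^sub>R J 2 x + d *\<^sub>R J 3 x"
  have lin: "linear_on H (J i)" and mem: "\<And>y. y \<in> H \<Longrightarrow> J i y \<in> H"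
    and sq: "\<And>y. y \<in> H \<Longrightarrow> J i (J i y) = - y" for i
    using J by (auto simp: abelian_hypercomplex_def endomorphism_on_def)
  have Jw: "J i w = a *\<^sub>R J i x + b *\<^sub>R J i (J 1 x) + c *\<^sub>R J i (J 2 x) + d *\<^sub>R J i (J 3 x)" for i
    unfolding w_def using x mem
    by (simp add: linear_on_add[OF lin] linear_on_scale[OF lin] subspace_add[OF H] subspace_scale[OF H])
  have "a *\<^sub>R w - b *\<^sub>R J 1 w - c *\<^sub>R J 2 w - d *\<^sub>R J 3 w = (a\<^sup>2 + b\<^sup>2 + c\<^sup>2 + d\<^sup>2) *\<^sub>R x"
    by (simp only: Jw sq[OF x] hypercomplex_relations[OF J H x])
      (simp add: w_def algebra_simps power2_eq_square)
  moreover have "a *\<^sub>R w - b *\<^sub>R J 1 w - c *\<^sub>R J 2 w - d *\<^sub>R J 3 w \<in> S"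
    using w inv unfolding w_def[symmetric] by (intro subspace_diff subspace_scale S) auto
  ultimately have "(a\<^sup>2 + b\<^sup>2 + c\<^sup>2 + d\<^sup>2) *\<^sub>R x \<in> S" by simp
  \<comment> \<open>Since \<open>inverse 0 = 0\<close>, this holds without a case distinction; a
    nonzero sum of squares would now put \<open>x\<close> into \<open>S\<close>.\<close>
  then have "inverse (a\<^sup>2 + b\<^sup>2 + c\<^sup>2 + d\<^sup>2) *\<^sub>R (a\<^sup>2 + b\<^sup>2 + c\<^sup>2 + d\<^sup>2) *\<^sub>R x \<in> S"
    by (rule subspace_scale[OF S])
  with nS have "a\<^sup>2 + b\<^sup>2 + c\<^sup>2 + d\<^sup>2 = 0" by (cases "a\<^sup>2 + b\<^sup>2 + c\<^sup>2 + d\<^sup>2 = 0") auto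
  then show ?thesis by (simp add: add_nonneg_eq_0_iff)
qed

lemma card_insert_notin_span: "a \<notin> span S \<Longrightarrow> finite S \<Longrightarrow> card (insert a S) = Suc (card S)"
  by (metis card_insert_disjoint span_base)

text \<open>Induction on \<open>card T - card B\<close>: every independent subset of
  \<open>H\<close> has at most \<open>card T\<close> elements, so adjoining a quaternionic line,
  four vectors at a time, must stop, and it stops only when \<open>B\<close> spans
  \<open>H\<close>.\<close>

lemma hypercomplex_dim_extend_basis:
  assumes J: "abelian_hypercomplex H br J" and H: "subspace H" and T: "finite T" "H \<subseteq> span T"
    and "independent B" "B \<subseteq> H" "\<And>i y. y \<in> span B \<Longrightarrow> J i y \<in> span B" "card B = 4 * n"
  shows "\<exists>m. dim H = 4 * m"
  using assms(5-)
proof (induction "card T - card B" arbitrary: B n rule: less_induct)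
  case less
  have bound: "finite C \<and> card C \<le> card T" if "independent C" "C \<subseteq> H" for C
    using independent_span_bound[OF T(1) that(1)] that(2) T(2) by auto
  show ?case
  proof (cases "H \<subseteq> span B")
    case True
    then have "dim H = card B" using dim_unique[OF less.prems(2) _ less.prems(1)] by simp
    then show ?thesis using less.prems by auto
  next
    case False
    then obtain x where x: "x \<in> H" "x \<notin> span B" by auto
    have lin: "linear_on H (J i)" and mem: "\<And>y. y \<in> H \<Longrightarrow> J i y \<in> H"
      and sq: "\<And>y. y \<in> H \<Longrightarrow> J i (J i y) = - y" for i
      using J by (auto simp: abelian_hypercomplex_def endomorphism_on_def)
    note comb = hypercomplex_comb_coeffs_zero[OF J H x(1) subspace_span less.prems(3) _ x(2)]
    let ?B1 = "insert x B" and ?B2 = "insert (J 1 x) (insert x B)"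
    let ?B3 = "insert (J 2 x) (insert (J 1 x) (insert x B))"
    let ?C = "insert (J 3 x) (insert (J 2 x) (insert (J 1 x) (insert x B)))"
    \<comment> \<open>In each of the three claims, membership would give a combination of
      \<open>x\<close> and the \<open>J i x\<close> lying in \<open>span B\<close> with one
      coefficient equal to \<open>1\<close>, against \<open>comb\<close>.\<close>
    have n1: "J 1 x \<notin> span ?B1"
    proof
      assume "J 1 x \<in> span ?B1"
      then obtain k where "J 1 x - k *\<^sub>R x \<in> span B" by (auto simp: span_breakdown_eq)
      then show False using comb[of "- k" 1 0 0] by simp
    qed
    have n2: "J 2 x \<notin> span ?B2"
    proof
      assume "J 2 x \<in> span ?B2"
      then obtain k l where "J 2 x - k *\<^sub>R J 1 x - l *\<^sub>R x \<in> span B" by (auto simp: span_breakdown_eq)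
      then show False using comb[of "- l" "- k" 1 0] by (simp add: algebra_simps)
    qed
    have n3: "J 3 x \<notin> span ?B3"
    proof
      assume "J 3 x \<in> span ?B3"
      then obtain k l m where "J 3 x - k *\<^sub>R J 2 x - l *\<^sub>R J 1 x - m *\<^sub>R x \<in> span B"
        by (auto simp: span_breakdown_eq)
      then show False using comb[of "- m" "- l" "- k" 1] by (simp add: algebra_simps)
    qed
    have ind: "independent ?C"
      using n1 n2 n3 x less.prems(1) by (intro independent_insertI)
    have sub: "?C \<subseteq> H" using x mem less.prems(2) by auto
    have "finite B" using bound less.prems by auto
    then have card: "card ?C = card B + 4"
      by (simp add: card_insert_notin_span n1 n2 n3 x(2) del: card_insert_if)
    \<comment> \<open>The quaternionic relations permute the four new vectors up to sign, and
      \<open>span B\<close> is invariant already, so the hypothesis of the induction passes to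
      \<open>?C\<close>.\<close>
    have "J i ` ?C \<subseteq> span ?C" for i
    proof -
      have J_mem: "J i x \<in> span ?C" for i
        using exhaust_3[of i] by (auto intro: span_base)
      then have "- J i x \<in> span ?C" for i by (rule span_neg)
      moreover have "J i y \<in> span ?C" if "y \<in> B" for i y
        using less.prems(3)[OF span_base[OF that]] span_mono[of B ?C] by blast
      moreover have "- x \<in> span ?C" by (simp add: span_base span_neg)
      ultimately show ?thesis
        using J_mem exhaust_3[of i] sq[OF x(1)] hypercomplex_relations[OF J H x(1)]
        by auto
    qed
    then have inv: "J i y \<in> span ?C" if "y \<in> span ?C" for i y
      using linear_on_span_image[OF lin H sub _ that] by blast
    \<comment> \<open>The bound \<open>card ?C \<le> card T\<close> makes the truncated difference
      drop strictly.\<close>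
    have "card T - card ?C < card T - card B"
      using bound[OF ind sub] card by linarith
    moreover have "card ?C = 4 * Suc n" using card less.prems(4) by simp
    ultimately show ?thesis using less.hyps[OF _ ind sub inv] by blast
  qed
qed

lemma hypercomplex_dim:
  assumes "abelian_hypercomplex H br J" "subspace H" "fin_dim H"
  shows "\<exists>m. dim H = 4 * m"
proof -
  \<comment> \<open>The extension starts from the empty set with \<open>n = 0\<close>; its span is
    the zero space, which must be invariant.\<close>
  have "J i 0 = 0" for i
    using assms linear_on_zero[of H "J i"] by (auto simp: abelian_hypercomplex_def endomorphism_on_def)
  then show ?thesis
    using assms hypercomplex_dim_extend_basis[OF assms(1,2), of _ "{}" 0]
    by (auto simp: fin_dim_def independent_empty)
qed

section \<open>Dimension of the product with \<real> cubed\<close>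

text \<open>A basis consists of the three unit vectors in the first factor and a copy of a basis of
  \<open>H\<close> in the second.\<close>

lemma dim_UNIV_Times:
  assumes "subspace H" "fin_dim H"
  shows "fin_dim ((UNIV :: (real^3) set) \<times> H)" "dim ((UNIV :: (real^3) set) \<times> H) = dim H + 3"
proof -
  obtain T where T: "finite T" "H \<subseteq> span T" using assms by (auto simp: fin_dim_def)
  obtain B where B: "B \<subseteq> H" "independent B" "H \<subseteq> span B" "card B = dim H"
    using basis_exists by blast
  have fin: "finite B" using independent_span_bound[OF T(1) B(2)] B T by auto
  let ?P = "Pair (0 :: real^3) :: 'a \<Rightarrow> _"
  let ?e = "\<lambda>i. (axis i 1 :: real^3, 0 :: 'a)"
  let ?C = "insert (?e 1) (insert (?e 2) (insert (?e 3) (?P ` B)))"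
  have lin: "linear ?P" by (intro linearI) auto
  have span: "span (?P ` B) = ?P ` span B" by (rule linear_span_image[OF lin])
  have mem: "p \<in> span ?C" if "p \<in> UNIV \<times> H" for p
  proof -
    have "p - (fst p $ 1) *\<^sub>R ?e 1 - (fst p $ 2) *\<^sub>R ?e 2 - (fst p $ 3) *\<^sub>R ?e 3 = ?P (snd p)"
      by (auto simp: prod_eq_iff vec_eq_iff axis_def forall_3)
    also have "\<dots> \<in> span (?P ` B)" using that B span by auto
    finally show ?thesis by (auto simp: span_breakdown_eq)
  qed
  then show "fin_dim ((UNIV :: (real^3) set) \<times> H)"
    using fin by (auto simp: fin_dim_def intro!: exI[of _ ?C])
  \<comment> \<open>Vectors in the span of the copy of \<open>B\<close> have first component
    \<open>0\<close>. In each claim the coordinate belonging to the new unit vector is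
    \<open>1\<close> and cannot be cancelled.\<close>
  have n3: "?e 3 \<notin> span (?P ` B)"
    unfolding span by (auto simp: vec_eq_iff axis_def forall_3)
  have n2: "?e 2 \<notin> span (insert (?e 3) (?P ` B))"
    unfolding span span_breakdown_eq by (auto simp: vec_eq_iff axis_def forall_3 prod_eq_iff)
  have n1: "?e 1 \<notin> span (insert (?e 2) (insert (?e 3) (?P ` B)))"
    unfolding span span_breakdown_eq by (auto simp: vec_eq_iff axis_def forall_3 prod_eq_iff)
  have ind: "independent (?P ` B)"
    by (rule linear_independent_injective_image[OF lin B(2)]) (simp add: inj_on_def)
  have "card (?P ` B) = dim H" using B by (simp add: card_image inj_on_def)
  then have card: "card ?C = dim H + 3"
    by (simp add: card_insert_notin_span n1 n2 n3 fin del: card_insert_if)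
  show "dim ((UNIV :: (real^3) set) \<times> H) = dim H + 3"
    using n1 n2 n3 ind mem B(1) assms(1)
    by (intro dim_unique[OF _ _ _ card] independent_insertI) (auto simp: subspace_0)
qed

section \<open>Identities of almost contact and almost 3-contact structures\<close>

text \<open>The square formula at \<open>\<xi>\<close> gives
  \<open>\<phi> (\<phi> \<xi>) = 0\<close>, and at \<open>\<phi> \<xi>\<close> it gives
  \<open>\<phi> \<xi> = c \<xi>\<close> with \<open>c = \<eta> (\<phi> \<xi>)\<close>. Applying
  \<open>\<phi>\<close> once more yields \<open>c (\<phi> \<xi>) = 0\<close>, and either factor
  being zero suffices.\<close>

lemma almost_contact_phi_xi:
  assumes L: "subspace L" and ac: "almost_contact L \<phi> \<xi> \<eta>"
  shows "\<phi> \<xi> = 0"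
proof -
  have lin: "linear_on L \<phi>" and mem: "\<And>x. x \<in> L \<Longrightarrow> \<phi> x \<in> L" and xi: "\<xi> \<in> L" "\<eta> \<xi> = 1"
    and sq: "\<And>x. x \<in> L \<Longrightarrow> \<phi> (\<phi> x) = - x + \<eta> x *\<^sub>R \<xi>" and eta: "linear_on L \<eta>"
    using ac by (auto simp: almost_contact_def endomorphism_on_def)
  have 0: "\<phi> (\<phi> \<xi>) = 0" using sq[of \<xi>] xi by simp
  then have 1: "\<phi> \<xi> = \<eta> (\<phi> \<xi>) *\<^sub>R \<xi>"
    using sq[of "\<phi> \<xi>"] linear_on_zero[OF lin L] xi mem by simp
  then have "\<eta> (\<phi> \<xi>) *\<^sub>R \<phi> \<xi> = 0"
    using linear_on_scale[OF lin xi(1)] 0 by metis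
  then show ?thesis using 1 by force
qed

text \<open>Computing the cube of \<open>\<phi>\<close> at \<open>x\<close> in two ways gives
  \<open>- \<phi> x\<close> and \<open>- \<phi> x + \<eta> (\<phi> x) \<xi>\<close>.\<close>

lemma almost_contact_eta_phi:
  assumes L: "subspace L" and ac: "almost_contact L \<phi> \<xi> \<eta>" and x: "x \<in> L"
  shows "\<eta> (\<phi> x) = 0"
proof -
  have lin: "linear_on L \<phi>" and mem: "\<And>x. x \<in> L \<Longrightarrow> \<phi> x \<in> L" and xi: "\<xi> \<in> L" "\<eta> \<xi> = 1"
    and sq: "\<And>x. x \<in> L \<Longrightarrow> \<phi> (\<phi> x) = - x + \<eta> x *\<^sub>R \<xi>" and eta: "linear_on L \<eta>"
    using ac by (auto simp: almost_contact_def endomorphism_on_def)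
  have "\<phi> (- x + \<eta> x *\<^sub>R \<xi>) = - \<phi> x"
    using x xi L almost_contact_phi_xi[OF L ac]
    by (simp add: linear_on_diff[OF lin L] linear_on_scale[OF lin] subspace_scale)
  then have "\<eta> (\<phi> x) *\<^sub>R \<xi> = 0"
    using sq[of x] sq[of "\<phi> x"] x mem by simp
  moreover have "\<xi> \<noteq> 0" using xi linear_on_zero[OF eta L] by auto
  ultimately show ?thesis by simp
qed

lemma three_contact_relations:
  assumes "almost_3_contact_lie_algebra L br \<phi> \<xi> \<eta>" "(i, j, k) \<in> even_triples" "x \<in> L"
  shows "\<phi> k x = \<phi> i (\<phi> j x) - \<eta> j x *\<^sub>R \<xi> i" "\<phi> k x = - \<phi> j (\<phi> i x) + \<eta> i x *\<^sub>R \<xi> j"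
    "\<xi> k = \<phi> i (\<xi> j)" "\<xi> k = - \<phi> j (\<xi> i)"
    "\<eta> k x = \<eta> i (\<phi> j x)" "\<eta> k x = - \<eta> j (\<phi> i x)"
  using assms(1,3) unfolding almost_3_contact_lie_algebra_def
  by - (elim conjE, drule bspec[OF _ assms(2)], unfold prod.case, blast)+

text \<open>For distinct indices \<open>\<eta> i (\<phi> j x)\<close> is, up to sign, the third form
  at \<open>x\<close>; for equal indices it vanishes on all of \<open>L\<close>. Hence each
  \<open>\<phi> j\<close> preserves the horizontal subspace.\<close>

lemma three_contact_eta_phi:
  assumes "almost_3_contact_lie_algebra L br \<phi> \<xi> \<eta>" "x \<in> L" "\<forall>i. \<eta> i x = 0"
  shows "\<eta> i (\<phi> j x) = 0"
proof -
  have L: "subspace L" and ac: "\<And>i. almost_contact L (\<phi> i) (\<xi> i) (\<eta> i)"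
    using assms by (auto simp: almost_3_contact_lie_algebra_def lie_algebra_def)
  have "\<eta> 1 (\<phi> 2 x) = 0 \<and> \<eta> 2 (\<phi> 1 x) = 0 \<and> \<eta> 2 (\<phi> 3 x) = 0 \<and> \<eta> 3 (\<phi> 2 x) = 0 \<and>
      \<eta> 3 (\<phi> 1 x) = 0 \<and> \<eta> 1 (\<phi> 3 x) = 0"
    using three_contact_relations(5,6)[OF assms(1) _ assms(2), of 1 2 3]
      three_contact_relations(5,6)[OF assms(1) _ assms(2), of 2 3 1]
      three_contact_relations(5,6)[OF assms(1) _ assms(2), of 3 1 2] assms(3)
    by (simp add: even_triples_def)
  then show ?thesis
    using exhaust_3[of i] exhaust_3[of j] almost_contact_eta_phi[OF L ac assms(2)] by metis
qed

text \<open>For an even triple, \<open>\<xi> k\<close> lies in the image of both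
  \<open>\<phi> i\<close> and \<open>\<phi> j\<close>, where \<open>\<eta> i\<close> and
  \<open>\<eta> j\<close> respectively vanish.\<close>

lemma three_contact_eta_xi:
  assumes "almost_3_contact_lie_algebra L br \<phi> \<xi> \<eta>"
  shows "\<eta> i (\<xi> j) = (if i = j then 1 else 0)"
proof -
  have L: "subspace L" and ac: "\<And>i. almost_contact L (\<phi> i) (\<xi> i) (\<eta> i)"
    using assms by (auto simp: almost_3_contact_lie_algebra_def lie_algebra_def)
  have xi: "\<xi> i \<in> L" "\<eta> i (\<xi> i) = 1" "linear_on L (\<eta> i)" "\<And>x. x \<in> L \<Longrightarrow> \<phi> i x \<in> L" for i
    using ac by (auto simp: almost_contact_def endomorphism_on_def)
  have *: "\<eta> i (\<xi> k) = 0 \<and> \<eta> j (\<xi> k) = 0" if "(i, j, k) \<in> even_triples" for i j k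
  proof -
    have "\<xi> k = \<phi> i (\<xi> j)" "\<xi> k = - \<phi> j (\<xi> i)"
      using three_contact_relations(3,4)[OF assms that] xi by blast+
    then show ?thesis
      using almost_contact_eta_phi[OF L ac] xi linear_on_neg by (metis neg_0_equal_iff_equal)
  qed
  have "\<eta> 1 (\<xi> 2) = 0 \<and> \<eta> 2 (\<xi> 1) = 0 \<and> \<eta> 2 (\<xi> 3) = 0 \<and> \<eta> 3 (\<xi> 2) = 0 \<and>
      \<eta> 3 (\<xi> 1) = 0 \<and> \<eta> 1 (\<xi> 3) = 0"
    using *[of 1 2 3] *[of 2 3 1] *[of 3 1 2] by (simp add: even_triples_def)
  then show ?thesis
    using exhaust_3[of i] exhaust_3[of j] xi(2) by auto
qed

section \<open>Splitting into vertical and horizontal parts\<close>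

definition vertical_proj :: "(3 \<Rightarrow> 'a::real_vector) \<Rightarrow> (3 \<Rightarrow> 'a \<Rightarrow> real) \<Rightarrow> 'a \<Rightarrow> 'a" where
  "vertical_proj \<xi> \<eta> x = (\<Sum>i\<in>UNIV. \<eta> i x *\<^sub>R \<xi> i)"

lemma vertical_proj_in: "vertical_proj \<xi> \<eta> x \<in> vertical \<xi>"
  unfolding vertical_proj_def vertical_def by (intro span_sum span_scale span_base) auto

lemma vertical_proj_linear:
  assumes "\<And>i. linear_on L (\<eta> i)"
  shows "linear_on L (vertical_proj \<xi> \<eta>)"
  using assms
  by (simp add: linear_on_def vertical_proj_def scaleR_add_left sum.distrib scaleR_sum_right)

lemma vertical_proj_horizontal: "x \<in> horizontal L \<eta> \<Longrightarrow> vertical_proj \<xi> \<eta> x = 0"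
  by (simp add: horizontal_def vertical_proj_def)

lemma vertical_subset:
  assumes "almost_3_contact_lie_algebra L br \<phi> \<xi> \<eta>"
  shows "vertical \<xi> \<subseteq> L"
  using assms unfolding vertical_def
  by (intro span_minimal) (auto simp: almost_3_contact_lie_algebra_def lie_algebra_def almost_contact_def)

text \<open>Duality of the \<open>\<eta> i\<close> and \<open>\<xi> j\<close>. It makes
  \<open>x - vertical_proj \<xi> \<eta> x\<close> horizontal for \<open>x\<close> in
  \<open>L\<close>.\<close>

lemma eta_vertical_proj:
  assumes 3: "almost_3_contact_lie_algebra L br \<phi> \<xi> \<eta>"
  shows "\<eta> i (vertical_proj \<xi> \<eta> x) = \<eta> i x"
proof -
  have L: "subspace L" and ac: "\<And>i. almost_contact L (\<phi> i) (\<xi> i) (\<eta> i)"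
    using 3 by (auto simp: almost_3_contact_lie_algebra_def lie_algebra_def)
  then have lin: "linear_on L (\<eta> i)" and xi: "\<And>j. \<xi> j \<in> L"
    by (auto simp: almost_contact_def)
  have "\<eta> i (vertical_proj \<xi> \<eta> x) = (\<Sum>j\<in>UNIV. \<eta> j x * \<eta> i (\<xi> j))"
    unfolding vertical_proj_def sum_3 using xi
    by (simp add: linear_on_add[OF lin] linear_on_scale[OF lin] subspace_add[OF L] subspace_scale[OF L])
  also have "\<dots> = \<eta> i x"
    by (simp add: three_contact_eta_xi[OF 3] if_distrib cong: if_cong)
  finally show ?thesis .
qed

lemma vertical_proj_vertical:
  assumes 3: "almost_3_contact_lie_algebra L br \<phi> \<xi> \<eta>" and v: "v \<in> vertical \<xi>"
  shows "vertical_proj \<xi> \<eta> v = v"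
proof -
  have L: "subspace L" and ac: "\<And>i. almost_contact L (\<phi> i) (\<xi> i) (\<eta> i)"
    using 3 by (auto simp: almost_3_contact_lie_algebra_def lie_algebra_def)
  then have lin: "linear_on L (vertical_proj \<xi> \<eta>)"
    by (intro vertical_proj_linear) (auto simp: almost_contact_def)
  have xi: "\<xi> j \<in> L" for j using ac by (auto simp: almost_contact_def)
  have gen: "vertical_proj \<xi> \<eta> (\<xi> i) = \<xi> i" for i
    by (simp add: vertical_proj_def three_contact_eta_xi[OF 3] if_distrib[of "\<lambda>c. c *\<^sub>R _"] cong: if_cong)
  have "v \<in> L \<and> vertical_proj \<xi> \<eta> v = v"
    using v unfolding vertical_def
  proof (induction rule: span_induct_alt)
    case base
    then show ?case using linear_on_zero[OF lin L] L by (simp add: subspace_0)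
  next
    case (step c y z)
    then have "y \<in> L" "z \<in> L" using xi by auto
    with step show ?case
      by (auto simp: linear_on_add[OF lin] linear_on_scale[OF lin] subspace_scale[OF L]
          subspace_add[OF L] gen)
  qed
  then show ?thesis ..
qed

text \<open>The hypercomplex structure is \<open>\<phi>\<close> itself: on \<open>H\<close> all
  correction terms containing some \<open>\<eta> i\<close> vanish, and what remains of the contact
  relations are the quaternionic ones.\<close>

lemma abelian_3_contact_decomposition:
  fixes \<xi> :: "3 \<Rightarrow> 'a::real_vector"
  assumes a3: "abelian_almost_3_contact_lie_algebra L br \<phi> \<xi> \<eta>"
    and center: "vertical \<xi> \<subseteq> lie_center L br"
  defines "P \<equiv> vertical_proj \<xi> \<eta>"
  defines "Q \<equiv> \<lambda>x. x - P x"
  defines "H \<equiv> horizontal L \<eta>"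
  defines "br0 \<equiv> \<lambda>x y. Q (br x y)" and "\<theta>0 \<equiv> \<lambda>x y. P (br x y)"
  shows "lie_algebra H br0" "abelian_hypercomplex H br0 \<phi>" "two_cocycle H br0 (vertical \<xi>) \<theta>0"
    "J_invariant H \<phi> \<theta>0"
    "lie_isomorphism (vertical \<xi> \<times> H) (central_ext_bracket \<theta>0 br0) L br (\<lambda>(v, x). v + x)"
proof -
  have 3: "almost_3_contact_lie_algebra L br \<phi> \<xi> \<eta>"
    and ab: "\<And>i. abelian_almost_contact L br (\<phi> i) (\<xi> i) (\<eta> i)"
    using a3 by (auto simp: abelian_almost_3_contact_lie_algebra_def)
  have L: "subspace L" and alt: "alternating_on L L br"
    and jac: "\<And>x y z. \<lbrakk>x \<in> L; y \<in> L; z \<in> L\<rbrakk> \<Longrightarrow> br (br x y) z + br (br y z) x + br (br z x) y = 0"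
    and ac: "\<And>i. almost_contact L (\<phi> i) (\<xi> i) (\<eta> i)"
    using 3 by (auto simp: almost_3_contact_lie_algebra_def lie_algebra_def)
  have eta: "linear_on L (\<eta> i)" and phi: "linear_on L (\<phi> i)" "\<And>x. x \<in> L \<Longrightarrow> \<phi> i x \<in> L"
    and sq: "\<And>x. x \<in> L \<Longrightarrow> \<phi> i (\<phi> i x) = - x + \<eta> i x *\<^sub>R \<xi> i" for i
    using ac by (auto simp: almost_contact_def endomorphism_on_def)
  have V: "vertical \<xi> \<subseteq> L" by (rule vertical_subset[OF 3])
  have H: "subspace H" "H \<subseteq> L"
    unfolding H_def horizontal_def subspace_def using L
    by (auto simp: linear_on_zero[OF eta L] linear_on_add[OF eta] linear_on_scale[OF eta]
        subspace_0 subspace_add subspace_scale)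
  have P: "linear_on L P" "P x \<in> vertical \<xi>" "P x \<in> L" for x
    unfolding P_def using vertical_proj_linear[of L \<eta>] eta vertical_proj_in V by blast+
  have Q: "linear_on L Q"
    using P(1) by (simp add: linear_on_def Q_def algebra_simps)
  have QH: "Q x \<in> H" if "x \<in> L" for x
    using that P(3)[of x] eta_vertical_proj[OF 3]
    by (auto simp: Q_def H_def horizontal_def P_def[symmetric] linear_on_diff[OF eta L] subspace_diff[OF L])
  have PH: "P x = 0" if "x \<in> H" for x
    using that vertical_proj_horizontal unfolding H_def P_def by blast
  have PV: "P v = v" if "v \<in> vertical \<xi>" for v
    using that vertical_proj_vertical[OF 3] unfolding P_def by blast
  have brL: "br x y \<in> L" if "x \<in> L" "y \<in> L" for x y
    using alt that by (auto simp: alternating_on_def)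
  have add1: "br (x + x') y = br x y + br x' y" and add2: "br y (x + x') = br y x + br y x'"
    if "x \<in> L" "x' \<in> L" "y \<in> L" for x x' y
    using alt that by (auto simp: alternating_on_def linear_on_def)
  have cen1: "br v x = 0" if "v \<in> vertical \<xi>" "x \<in> L" for v x
    using center that by (auto simp: lie_center_def)
  have cen2: "br x v = 0" if "v \<in> vertical \<xi>" "x \<in> L" for v x
    using alternating_on_skew[OF alt L, of v x] cen1[OF that] that V by auto
  \<comment> \<open>\<open>br0 x y\<close> and \<open>br x y\<close> differ by a vertical vector,
    which is central and disappears in a further bracket.\<close>
  have br0: "br (br0 x y) z = br (br x y) z" if "x \<in> L" "y \<in> L" "z \<in> L" for x y z
    using add1[of "br0 x y" "P (br x y)" z] that cen1[OF P(2)] P(3) QH[of "br x y"] H brL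
    by (auto simp: br0_def Q_def)
  \<comment> \<open>Keeping \<open>f\<close> general serves twice: \<open>f = Q\<close> gives the
    Jacobi identity of \<open>br0\<close>, \<open>f = P\<close> the cocycle identity of
    \<open>\<theta>0\<close>.\<close>
  have jac0: "f (br (br0 x y) z) + f (br (br0 y z) x) + f (br (br0 z x) y) = 0"
    if f: "linear_on L f" and "x \<in> H" "y \<in> H" "z \<in> H" for x y z and f :: "'a \<Rightarrow> 'a"
  proof -
    have m: "x \<in> L" "y \<in> L" "z \<in> L" using that H by auto
    then have "f (br (br x y) z) + f (br (br y z) x) + f (br (br z x) y) = f 0"
      by (simp add: jac brL subspace_add[OF L] flip: linear_on_add[OF f])
    then show ?thesis using m by (simp add: br0 linear_on_zero[OF f L])
  qed
  show "lie_algebra H br0"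
    unfolding lie_algebra_def
    using H(1) alternating_on_compose[OF alt Q _ H(2), of H] QH jac0[OF Q]
    by (auto simp: br0_def image_subset_iff)
  show "two_cocycle H br0 (vertical \<xi>) \<theta>0"
    unfolding two_cocycle_def
    using alternating_on_compose[OF alt P(1) _ H(2), of "vertical \<xi>"] P(2) jac0[OF P(1)]
    by (auto simp: \<theta>0_def image_subset_iff)
  \<comment> \<open>\<open>H\<close> lies in the kernel of every \<open>\<eta> i\<close>. Applying
    \<open>P\<close> and \<open>Q\<close> to this identity gives the invariance of
    \<open>\<theta>0\<close> and of \<open>br0\<close>.\<close>
  have inv: "br (\<phi> i x) (\<phi> i y) = br x y" if "x \<in> H" "y \<in> H" for i x y
    using ab[of i] that by (auto simp: abelian_almost_contact_def H_def horizontal_def)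
  then show "J_invariant H \<phi> \<theta>0" by (simp add: J_invariant_def \<theta>0_def)
  have "\<phi> i x \<in> H" if "x \<in> H" for i x
    using that phi(2) three_contact_eta_phi[OF 3] by (auto simp: H_def horizontal_def)
  moreover have "linear_on H (\<phi> i)" for i
    using phi(1)[of i] H(2) by (auto simp: linear_on_def subset_iff)
  moreover have "\<phi> i (\<phi> i x) = - x" if "x \<in> H" for i x
    using that sq[of x i] by (auto simp: H_def horizontal_def)
  moreover have "\<phi> 1 (\<phi> 2 x) = \<phi> 3 x \<and> - \<phi> 2 (\<phi> 1 x) = \<phi> 3 x" if "x \<in> H" for x
    using three_contact_relations(1,2)[OF 3, of 1 2 3 x] that
    by (simp add: even_triples_def H_def horizontal_def)
  ultimately show "abelian_hypercomplex H br0 \<phi>"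
    using inv by (auto simp: abelian_hypercomplex_def endomorphism_on_def br0_def)
  let ?f = "\<lambda>(v, x). v + x"
  have "bij_betw ?f (vertical \<xi> \<times> H) L"
  proof (rule bij_betw_byWitness[where f' = "\<lambda>x. (P x, Q x)"])
    show "\<forall>p\<in>vertical \<xi> \<times> H. (P (?f p), Q (?f p)) = p"
      using V H by (auto simp: Q_def linear_on_add[OF P(1)] PV PH subset_iff)
    show "\<forall>x\<in>L. ?f (P x, Q x) = x" by (simp add: Q_def)
    show "?f ` (vertical \<xi> \<times> H) \<subseteq> L" using V H by (auto intro!: subspace_add[OF L])
    show "(\<lambda>x. (P x, Q x)) ` L \<subseteq> vertical \<xi> \<times> H" using P QH by auto
  qed
  moreover have "linear_on (vertical \<xi> \<times> H) ?f"
    by (auto simp: linear_on_def scaleR_add_right)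
  moreover have "?f (central_ext_bracket \<theta>0 br0 p q) = br (?f p) (?f q)"
    if pq: "p \<in> vertical \<xi> \<times> H" "q \<in> vertical \<xi> \<times> H" for p q
  proof -
    obtain v x w y where p: "p = (v, x)" "q = (w, y)" by fastforce
    then have m: "v \<in> vertical \<xi>" "w \<in> vertical \<xi>" "v \<in> L" "w \<in> L" "x \<in> L" "y \<in> L"
      using pq V H by auto
    \<comment> \<open>All terms containing \<open>v\<close> or \<open>w\<close> vanish by
      centrality; \<open>br x y\<close> is then the sum of its images under \<open>P\<close> and
      \<open>Q\<close>.\<close>
    then have "br (v + x) (w + y) = br x y"
      by (simp add: add1 add2 cen1 cen2 subspace_add[OF L])
    then show ?thesis by (simp add: p central_ext_bracket_def \<theta>0_def br0_def Q_def)
  qed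
  ultimately show "lie_isomorphism (vertical \<xi> \<times> H) (central_ext_bracket \<theta>0 br0) L br ?f"
    by (simp add: lie_isomorphism_def)
qed

section \<open>The natural structure on the central extension\<close>

text \<open>A nested bracket uses only the \<open>H\<close>-components, so the Jacobi identity
  splits into the cocycle identity in the first component and the Jacobi identity of
  \<open>H\<close> in the second.\<close>

lemma central_ext_lie_algebra:
  assumes br: "lie_algebra H br" and \<theta>: "two_cocycle H br UNIV \<theta>"
  shows "lie_algebra (UNIV \<times> H) (central_ext_bracket \<theta> br)"
proof -
  have "alternating_on H H br" "alternating_on H UNIV \<theta>"
    using assms by (auto simp: lie_algebra_def two_cocycle_def)
  then have "alternating_on (UNIV \<times> H) (UNIV \<times> H) (central_ext_bracket \<theta> br)"
    unfolding alternating_on_def linear_on_def central_ext_bracket_def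
    by (simp add: zero_prod_def split_paired_Ball_Sigma)
  then show ?thesis
    using assms subspace_Times[OF subspace_UNIV, of H]
    by (simp add: lie_algebra_def two_cocycle_def central_ext_bracket_def zero_prod_def)
qed

lemma natural_structure_abelian_almost_3_contact:
  assumes br: "lie_algebra H br" "fin_dim H" and J: "abelian_hypercomplex H br J"
    and \<theta>: "two_cocycle H br UNIV \<theta>" "J_invariant H J \<theta>"
  shows "abelian_almost_3_contact_lie_algebra (UNIV \<times> H) (central_ext_bracket \<theta> br)
    (natural_phi J) natural_xi natural_eta"
proof -
  have H: "subspace H" and alt: "alternating_on H H br" using br by (auto simp: lie_algebra_def)
  have lin: "linear_on H (J i)" and mem: "\<And>y. y \<in> H \<Longrightarrow> J i y \<in> H"
    and sq: "\<And>y. y \<in> H \<Longrightarrow> J i (J i y) = - y"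
    and inv: "\<And>x y. x \<in> H \<Longrightarrow> y \<in> H \<Longrightarrow> br (J i x) (J i y) = br x y" for i
    using J by (auto simp: abelian_hypercomplex_def endomorphism_on_def)
  have J0: "J i 0 = 0" for i using linear_on_zero[OF lin H] .
  note rel = hypercomplex_relations[OF J H]
  \<comment> \<open>The square formula for the structure on the first factor: the triple product
    identity for a unit vector.\<close>
  have cross: "cross3 (axis i 1) (cross3 (axis i 1) v) = - v + v $ i *\<^sub>R axis i 1" for i v
    using exhaust_3[of i] by (auto simp: cross3_def vec_eq_iff forall_3 axis_def)
  have endo: "endomorphism_on (UNIV \<times> H) (natural_phi J i)" for i
    using mem lin[of i]
    by (auto simp: endomorphism_on_def linear_on_def natural_phi_def cross_add_right cross_mult_right)
  have ac: "almost_contact (UNIV \<times> H) (natural_phi J i) (natural_xi i) (natural_eta i)" for i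
    using endo H
    by (auto simp: almost_contact_def natural_phi_def natural_xi_def natural_eta_def linear_on_def
        cross sq subspace_0)
  \<comment> \<open>\<open>natural_xi i\<close> has \<open>H\<close>-component \<open>0\<close>, so
    brackets with it vanish and both sides of the commutation condition are zero.\<close>
  have zero: "br 0 x = 0" "\<theta> 0 x = 0" if "x \<in> H" for x
    using alt \<theta>(1) that linear_on_zero[OF _ H, of "\<lambda>y. br y x"] linear_on_zero[OF _ H, of "\<lambda>y. \<theta> y x"]
    by (auto simp: alternating_on_def two_cocycle_def)
  have "abelian_almost_contact (UNIV \<times> H) (central_ext_bracket \<theta> br)
      (natural_phi J i) (natural_xi i) (natural_eta i)" for i
    using ac mem inv \<theta>(2)
    by (auto simp: abelian_almost_contact_def central_ext_bracket_def natural_xi_def natural_phi_def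
        zero J0 J_invariant_def)
  moreover obtain m where "dim H = 4 * m" using hypercomplex_dim[OF J H br(2)] by blast
  then have "\<exists>n. dim ((UNIV :: (real^3) set) \<times> H) = 4 * n + 3"
    using dim_UNIV_Times[OF H br(2)] by auto
  \<comment> \<open>On the first factor the product rules amount to
    \<open>(e_i x e_j) x v = v_i e_j - v_j e_i\<close>, checked in coordinates; on \<open>H\<close>
    they are the quaternionic relations.\<close>
  moreover have "\<forall>(i, j, k) \<in> even_triples.
        (\<forall>x\<in>UNIV \<times> H. natural_phi J k x =
          natural_phi J i (natural_phi J j x) - natural_eta j x *\<^sub>R natural_xi i) \<and>
        (\<forall>x\<in>UNIV \<times> H. natural_phi J k x =
          - natural_phi J j (natural_phi J i x) + natural_eta i x *\<^sub>R natural_xi j) \<and>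
        (natural_xi k :: (real^3) \<times> 'a) = natural_phi J i (natural_xi j) \<and>
        natural_xi k = - natural_phi J j (natural_xi i) \<and>
        (\<forall>x\<in>UNIV \<times> H. natural_eta k x = natural_eta i (natural_phi J j x)) \<and>
        (\<forall>x\<in>UNIV \<times> H. natural_eta k x = - natural_eta j (natural_phi J i x))"
    unfolding even_triples_def
    by (auto simp: natural_phi_def natural_xi_def natural_eta_def rel J0
        cross3_def vec_eq_iff forall_3 axis_def)
  ultimately show ?thesis
    using ac central_ext_lie_algebra[OF br(1) \<theta>(1)] dim_UNIV_Times[OF H br(2)]
    by (simp add: abelian_almost_3_contact_lie_algebra_def almost_3_contact_lie_algebra_def)
qed

theorem proposition4p15:
  fixes \<g> :: "'a::real_vector set" and br :: "'a \<Rightarrow> 'a \<Rightarrow> 'a"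
    and \<phi> :: "3 \<Rightarrow> 'a \<Rightarrow> 'a" and \<xi> :: "3 \<Rightarrow> 'a" and \<eta> :: "3 \<Rightarrow> 'a \<Rightarrow> real"
    and \<h> :: "'b::real_vector set" and brh :: "'b \<Rightarrow> 'b \<Rightarrow> 'b"
    and J :: "3 \<Rightarrow> 'b \<Rightarrow> 'b" and \<theta> :: "'b \<Rightarrow> 'b \<Rightarrow> real^3"
  shows
    "(abelian_almost_3_contact_lie_algebra \<g> br \<phi> \<xi> \<eta> \<and> vertical \<xi> \<subseteq> lie_center \<g> br \<longrightarrow>
       (\<exists>br0 J0 \<theta>0.
          lie_algebra (horizontal \<g> \<eta>) br0 \<and>
          abelian_hypercomplex (horizontal \<g> \<eta>) br0 J0 \<and>
          two_cocycle (horizontal \<g> \<eta>) br0 (vertical \<xi>) \<theta>0 \<and>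
          J_invariant (horizontal \<g> \<eta>) J0 \<theta>0 \<and>
          lie_isomorphism (vertical \<xi> \<times> horizontal \<g> \<eta>) (central_ext_bracket \<theta>0 br0)
            \<g> br (\<lambda>(v, x). v + x)))
     \<and>
     (lie_algebra \<h> brh \<and> fin_dim \<h> \<and> abelian_hypercomplex \<h> brh J \<and>
      two_cocycle \<h> brh UNIV \<theta> \<and> J_invariant \<h> J \<theta> \<longrightarrow>
       abelian_almost_3_contact_lie_algebra (UNIV \<times> \<h>) (central_ext_bracket \<theta> brh)
         (natural_phi J) natural_xi natural_eta)"
proof (intro conjI impI)
  assume "abelian_almost_3_contact_lie_algebra \<g> br \<phi> \<xi> \<eta> \<and> vertical \<xi> \<subseteq> lie_center \<g> br"
  then show "\<exists>br0 J0 \<theta>0.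
          lie_algebra (horizontal \<g> \<eta>) br0 \<and>
          abelian_hypercomplex (horizontal \<g> \<eta>) br0 J0 \<and>
          two_cocycle (horizontal \<g> \<eta>) br0 (vertical \<xi>) \<theta>0 \<and>
          J_invariant (horizontal \<g> \<eta>) J0 \<theta>0 \<and>
          lie_isomorphism (vertical \<xi> \<times> horizontal \<g> \<eta>) (central_ext_bracket \<theta>0 br0)
            \<g> br (\<lambda>(v, x). v + x)"
    using abelian_3_contact_decomposition[of \<g> br \<phi> \<xi> \<eta>] by blast
next
  assume "lie_algebra \<h> brh \<and> fin_dim \<h> \<and> abelian_hypercomplex \<h> brh J \<and>
      two_cocycle \<h> brh UNIV \<theta> \<and> J_invariant \<h> J \<theta>"
  then show "abelian_almost_3_contact_lie_algebra (UNIV \<times> \<h>) (central_ext_bracket \<theta> brh)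
         (natural_phi J) natural_xi natural_eta"
    using natural_structure_abelian_almost_3_contact by blast
qed

end
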